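(* If $G$ is a nice graph, then $\mathrm{ch}_\Pi^*(G) \leq 2\Delta(G)-1$.
   Context: Graphs are finite and simple. A graph is nice if it has no connected component isomorphic to $K_2$. $\Delta(G)$ is the maximum degree of $G$. A $k$-list assignment $L$ of $G$ assigns to every edge $e \in E(G)$ a set $L(e)$ of $k$ real numbers. An $L$-labelling is a map $\ell$ on $E(G)$ with $\ell(e) \in L(e)$ for every edge $e$. For a vertex $v$ with neighbourhood $N(v)$, set $\pi_\ell(v)=\prod_{w \in N(v)} \ell(vw)$. The labelling $\ell$ is p-proper if $\pi_\ell(u) \neq \pi_\ell(v)$ for every edge $uv$. $\mathrm{ch}_\Pi^*(G)$ is the smallest $k \geq 1$, if any, such that $G$ admits a p-proper $L$-labelling for every $k$-list assignment $L$ with $0 \notin L(e)$ for every edge $e$.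
   Formalization: The graph G is assumed to have at least one edge; for an edgeless graph with a vertex, which is nice, the choice number is 1 while 2Δ(G)−1 = −1, so the bound fails (and Δ is undefined for the graph without vertices). *)

theory Defs
  imports Complex_Main "HOL-Library.Extended_Nat"
begin

text \<open>A graph is given by its vertex set and its edge set, the edges being two-element vertex sets.\<close>

definition simple_graph :: "'a set \<Rightarrow> 'a set set \<Rightarrow> bool" where
  "simple_graph V E \<longleftrightarrow> finite V \<and> (\<forall>e\<in>E. e \<subseteq> V \<and> card e = 2)"

definition neighbourhood :: "'a set set \<Rightarrow> 'a \<Rightarrow> 'a set" where
  "neighbourhood E v = {w. {v, w} \<in> E}"

definition degree :: "'a set set \<Rightarrow> 'a \<Rightarrow> nat" where
  "degree E v = card (neighbourhood E v)"

text \<open>Only meaningful for a nonempty vertex set.\<close>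

definition max_degree :: "'a set \<Rightarrow> 'a set set \<Rightarrow> nat" where
  "max_degree V E = Max (degree E ` V)"

definition connected_in :: "'a set \<Rightarrow> 'a set set \<Rightarrow> ('a \<times> 'a) set" where
  "connected_in V E = {(u, v). u \<in> V \<and> v \<in> V \<and> (u, v) \<in> {(x, y). {x, y} \<in> E}\<^sup>*}"

definition induced_edges :: "'a set set \<Rightarrow> 'a set \<Rightarrow> 'a set set" where
  "induced_edges E C = {e \<in> E. e \<subseteq> C}"

definition graph_isomorphic :: "'a set \<Rightarrow> 'a set set \<Rightarrow> 'b set \<Rightarrow> 'b set set \<Rightarrow> bool" where
  "graph_isomorphic V E V' E' \<longleftrightarrow>
     (\<exists>f. bij_betw f V V' \<and> (\<forall>u\<in>V. \<forall>v\<in>V. {u, v} \<in> E \<longleftrightarrow> {f u, f v} \<in> E'))"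

text \<open>The connected components are the subgraphs induced by the classes of \<open>connected_in V E\<close>;
  \<open>K\<^sub>2\<close> is realised on the vertex set \<open>{0, 1}\<close>.\<close>

definition nice :: "'a set \<Rightarrow> 'a set set \<Rightarrow> bool" where
  "nice V E \<longleftrightarrow>
     (\<forall>C \<in> V // connected_in V E.
        \<not> graph_isomorphic C (induced_edges E C) {0, 1 :: nat} {{0, 1}})"

definition list_assignment :: "'a set set \<Rightarrow> nat \<Rightarrow> ('a set \<Rightarrow> real set) \<Rightarrow> bool" where
  "list_assignment E k L \<longleftrightarrow> (\<forall>e\<in>E. finite (L e) \<and> card (L e) = k)"

definition labelling :: "'a set set \<Rightarrow> ('a set \<Rightarrow> real set) \<Rightarrow> ('a set \<Rightarrow> real) \<Rightarrow> bool" where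
  "labelling E L l \<longleftrightarrow> (\<forall>e\<in>E. l e \<in> L e)"

definition vertex_product :: "'a set set \<Rightarrow> ('a set \<Rightarrow> real) \<Rightarrow> 'a \<Rightarrow> real" where
  "vertex_product E l v = (\<Prod>w\<in>neighbourhood E v. l {v, w})"

definition p_proper :: "'a set set \<Rightarrow> ('a set \<Rightarrow> real) \<Rightarrow> bool" where
  "p_proper E l \<longleftrightarrow> (\<forall>u v. {u, v} \<in> E \<longrightarrow> vertex_product E l u \<noteq> vertex_product E l v)"

definition p_proper_choosable :: "'a set set \<Rightarrow> nat \<Rightarrow> bool" where
  "p_proper_choosable E k \<longleftrightarrow>
     (\<forall>L. list_assignment E k L \<and> (\<forall>e\<in>E. 0 \<notin> L e) \<longrightarrow>
        (\<exists>l. labelling E L l \<and> p_proper E l))"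

text \<open>The value is \<open>\<infinity>\<close> if no \<open>k\<close> works. Isolated vertices play no role, so the edge set suffices.\<close>

definition ch_Pi_star :: "'a set set \<Rightarrow> enat" where
  "ch_Pi_star E = (INF k\<in>{k. 1 \<le> k \<and> p_proper_choosable E k}. enat k)"

end

theory Submission imports Defs begin

text \<open>Label the edges greedily in any order. Whether the ends of an edge \<open>f\<close> get equal products
  does not depend on the label of \<open>f\<close> itself, so it is decided when the last edge adjacent
  to \<open>f\<close> is labelled; such an edge exists because the graph is nice. An edge \<open>e\<close> thus only has to
  decide about at most \<open>2\<Delta> - 2\<close> adjacent edges \<open>f\<close>, and each of them rules out at most one
  value, because labels are nonzero and \<open>e\<close> enters the product of exactly one end of \<open>f\<close>.\<close>

definition adjacent_edges :: "'a set set \<Rightarrow> 'a set \<Rightarrow> 'a set set" where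
  "adjacent_edges E e = {f \<in> E. f \<noteq> e \<and> f \<inter> e \<noteq> {}}"

text \<open>A violation of \<open>p_proper\<close> located at the single edge \<open>f\<close>, so
  that it can be followed edge by edge. The ends are quantified because edges are unordered
  sets.\<close>

definition conflict :: "'a set set \<Rightarrow> ('a set \<Rightarrow> real) \<Rightarrow> 'a set \<Rightarrow> bool" where
  "conflict E l f \<longleftrightarrow> (\<exists>x y. f = {x, y} \<and> x \<noteq> y \<and> vertex_product E l x = vertex_product E l y)"

lemma finite_edges:
  assumes "simple_graph V E"
  shows "finite E"
proof -
  have "E \<subseteq> Pow V" "finite V"
    using assms by (auto simp: simple_graph_def)
  then show ?thesis
    by (meson finite_Pow_iff finite_subset)
qed

lemma edge_ends_distinct:
  assumes "simple_graph V E" "{x, y} \<in> E"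
  shows "x \<noteq> y"
  using assms by (auto simp: simple_graph_def)

lemma edgeE:
  assumes "simple_graph V E" "e \<in> E"
  obtains x y where "e = {x, y}" "x \<noteq> y" "x \<in> V" "y \<in> V"
proof -
  have "card e = 2" "e \<subseteq> V"
    using assms by (auto simp: simple_graph_def)
  then show ?thesis
    using that by (auto simp: card_2_iff)
qed

lemma finite_neighbourhood:
  assumes "simple_graph V E"
  shows "finite (neighbourhood E v)"
proof -
  have "neighbourhood E v \<subseteq> V" "finite V"
    using assms by (auto simp: simple_graph_def neighbourhood_def)
  then show ?thesis
    by (rule finite_subset)
qed

lemma degree_le_max_degree:
  assumes "simple_graph V E" "v \<in> V"
  shows "degree E v \<le> max_degree V E"
  using assms by (auto simp: max_degree_def simple_graph_def)

lemma degree_pos: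
  assumes "simple_graph V E" "{x, y} \<in> E"
  shows "degree E x \<ge> 1"
proof -
  have "y \<in> neighbourhood E x"
    using assms by (simp add: neighbourhood_def)
  then have "degree E x > 0"
    using finite_neighbourhood[OF assms(1)] by (auto simp: degree_def card_gt_0_iff)
  then show ?thesis by simp
qed

text \<open>Two distinct two-element sets that meet share exactly one point. This asymmetry is why
  relabelling \<open>e\<close> affects the product at exactly one end of \<open>f\<close>.\<close>

lemma adjacent_edgeE:
  assumes G: "simple_graph V E" and e: "e \<in> E" and f: "f \<in> adjacent_edges E e"
  obtains x y where "f = {x, y}" "x \<in> e" "y \<notin> e"
proof -
  have fE: "f \<in> E" "f \<noteq> e" "f \<inter> e \<noteq> {}"
    using f by (auto simp: adjacent_edges_def)
  obtain p q where pq: "f = {p, q}" "p \<noteq> q"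
    using G fE(1) by (rule edgeE)
  have "\<not> f \<subseteq> e"
    using G e fE by (metis card_subset_eq card.infinite simple_graph_def zero_neq_numeral)
  then have "p \<in> e \<and> q \<notin> e \<or> q \<in> e \<and> p \<notin> e"
    using fE(3) pq(1) by auto
  then show ?thesis
    using that pq(1) by (metis insert_commute)
qed

text \<open>Every adjacent edge passes through one of the two ends of \<open>e\<close>, and each end
  has at most \<Delta> edges, one of them \<open>e\<close> itself.\<close>

lemma card_adjacent_edges_le:
  assumes G: "simple_graph V E" and e: "e \<in> E"
  shows "card (adjacent_edges E e) \<le> 2 * max_degree V E - 2"
proof -
  obtain x y where xy: "e = {x, y}" "x \<noteq> y" "x \<in> V" "y \<in> V"
    using G e by (rule edgeE)
  define X where "X = (\<lambda>w. {x, w}) ` (neighbourhood E x - {y})"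
  define Y where "Y = (\<lambda>w. {y, w}) ` (neighbourhood E y - {x})"
  have "adjacent_edges E e \<subseteq> X \<union> Y"
  proof
    fix f assume f: "f \<in> adjacent_edges E e"
    then have fE: "f \<in> E"
      by (simp add: adjacent_edges_def)
    obtain a b where ab: "f = {a, b}" "a \<in> e" "b \<notin> e"
      using G e f by (rule adjacent_edgeE)
    then consider "a = x" | "a = y"
      using xy by blast
    then show "f \<in> X \<union> Y"
    proof cases
      case 1
      then have "b \<in> neighbourhood E x - {y}"
        using fE ab xy by (simp add: neighbourhood_def)
      then show ?thesis
        using ab(1) 1 by (auto simp: X_def)
    next
      case 2
      then have "b \<in> neighbourhood E y - {x}"
        using fE ab xy by (simp add: neighbourhood_def)
      then show ?thesis
        using ab(1) 2 by (auto simp: Y_def)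
    qed
  qed
  moreover have "finite X" "finite Y"
    using finite_neighbourhood[OF G] by (auto simp: X_def Y_def)
  ultimately have "card (adjacent_edges E e) \<le> card X + card Y"
    by (meson card_Un_le card_mono finite_UnI le_trans)
  also have "card X \<le> card (neighbourhood E x - {y})"
    unfolding X_def by (intro card_image_le) (simp add: finite_neighbourhood[OF G])
  also have "\<dots> = degree E x - 1"
    using e xy by (simp add: degree_def neighbourhood_def)
  also have "card Y \<le> card (neighbourhood E y - {x})"
    unfolding Y_def by (intro card_image_le) (simp add: finite_neighbourhood[OF G])
  also have "\<dots> = degree E y - 1"
    using e xy by (simp add: degree_def neighbourhood_def insert_commute)
  finally show ?thesis
    using degree_le_max_degree[OF G xy(3)] degree_le_max_degree[OF G xy(4)] by simp
qed

text \<open>Here niceness enters: an edge that meets no other edge would span a component isomorphic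
  to \<open>K\<^sub>2\<close>.\<close>

lemma adjacent_edges_nonempty:
  assumes G: "simple_graph V E" and N: "nice V E" and e: "e \<in> E"
  shows "adjacent_edges E e \<noteq> {}"
proof
  assume A: "adjacent_edges E e = {}"
  obtain x y where xy: "e = {x, y}" "x \<noteq> y" "x \<in> V" "y \<in> V"
    using G e by (rule edgeE)
  have isolated: "f = e" if "f \<in> E" "f \<inter> e \<noteq> {}" for f
    using A that by (auto simp: adjacent_edges_def)
  \<comment> \<open>A walk from \<open>x\<close> cannot leave \<open>{x, y}\<close>: its next edge
    would meet \<open>e\<close> and hence be \<open>e\<close>.\<close>
  have closed: "w \<in> {x, y}" if "(x, w) \<in> {(a, b). {a, b} \<in> E}\<^sup>*" for w
    using that
  proof induction
    case (step b c)
    then have "{b, c} = e"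
      using xy by (intro isolated) auto
    then show ?case
      using xy by auto
  qed simp
  have "(x, y) \<in> {(a, b). {a, b} \<in> E}\<^sup>*"
    using e xy by auto
  then have "connected_in V E `` {x} = {x, y}"
    using closed xy by (auto simp: connected_in_def)
  then have "{x, y} \<in> V // connected_in V E"
    using xy by (metis quotientI)
  moreover have "graph_isomorphic {x, y} (induced_edges E {x, y}) {0, 1 :: nat} {{0, 1}}"
    unfolding graph_isomorphic_def
  proof (intro exI conjI ballI)
    let ?f = "\<lambda>v. if v = x then 0 else 1 :: nat"
    show "bij_betw ?f {x, y} {0, 1}"
      using xy by (auto simp: bij_betw_def inj_on_def)
    fix u v assume "u \<in> {x, y}" "v \<in> {x, y}"
    \<comment> \<open>This settles the case \<open>u = v\<close> of the equivalence, where
      \<open>{u, v}\<close> collapses to a singleton.\<close>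
    moreover have "{x} \<notin> E" "{y} \<notin> E"
      using G by (auto simp: simple_graph_def)
    ultimately show "{u, v} \<in> induced_edges E {x, y} \<longleftrightarrow> {?f u, ?f v} \<in> {{0, 1}}"
      using e xy by (auto simp: induced_edges_def insert_commute doubleton_eq_iff)
  qed
  ultimately show False
    using N by (auto simp: nice_def)
qed

lemma vertex_product_nonzero:
  assumes "simple_graph V E" "\<And>e. e \<in> E \<Longrightarrow> l e \<noteq> 0"
  shows "vertex_product E l x \<noteq> 0"
  using assms finite_neighbourhood[OF assms(1)]
  by (auto simp: vertex_product_def neighbourhood_def)

text \<open>The label of \<open>e\<close> is a factor of the product at \<open>x\<close> only if
  \<open>x \<in> e\<close>, and then exactly once; as it is nonzero, it can be exchanged by
  division.\<close>

lemma vertex_product_update: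
  assumes G: "simple_graph V E" and e: "e \<in> E" and nz: "l e \<noteq> 0"
  shows "vertex_product E (l(e := c)) x
    = (if x \<in> e then c / l e * vertex_product E l x else vertex_product E l x)"
proof (cases "x \<in> e")
  case True
  then obtain y where y: "e = {x, y}"
    using edgeE[OF G e] by (metis doubleton_eq_iff insert_iff singletonD)
  then have N: "y \<in> neighbourhood E x"
    using e by (simp add: neighbourhood_def)
  have "(\<Prod>w\<in>neighbourhood E x - {y}. (l(e := c)) {x, w}) = (\<Prod>w\<in>neighbourhood E x - {y}. l {x, w})"
    by (intro prod.cong) (auto simp: y doubleton_eq_iff)
  then show ?thesis
    using True nz y unfolding vertex_product_def
    by (simp add: prod.remove[OF finite_neighbourhood[OF G] N])
next
  case False
  then have "vertex_product E (l(e := c)) x = vertex_product E l x"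
    unfolding vertex_product_def by (intro prod.cong) auto
  then show ?thesis
    using False by simp
qed

text \<open>If \<open>f = e\<close>, the products at both ends are scaled by the same nonzero factor
  \<open>c / l e\<close>; if \<open>f\<close> is disjoint from \<open>e\<close>, neither product
  changes.\<close>

lemma conflict_update_not_adjacent:
  assumes G: "simple_graph V E" and e: "e \<in> E" "l e \<noteq> 0" and c: "c \<noteq> 0"
    and f: "f \<in> E" "e \<notin> adjacent_edges E f"
  shows "conflict E (l(e := c)) f \<longleftrightarrow> conflict E l f"
proof -
  have "f = e \<or> f \<inter> e = {}"
    using e f by (auto simp: adjacent_edges_def)
  then show ?thesis
    unfolding conflict_def using vertex_product_update[of V E e l c, OF G e] e(2) c
    by (intro ex_cong1) auto
qed

text \<open>Only the end of \<open>f\<close> that lies in \<open>e\<close> has a product depending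
  on \<open>c\<close>, and this product is \<open>c\<close> times a nonzero constant. Equality of
  the two products is thus a linear equation with a single solution.\<close>

lemma conflict_value_unique:
  assumes G: "simple_graph V E" and nz: "\<And>e. e \<in> E \<Longrightarrow> l e \<noteq> 0"
    and e: "e \<in> E" and f: "f \<in> adjacent_edges E e"
  shows "\<exists>b. \<forall>c. conflict E (l(e := c)) f \<longrightarrow> c = b"
proof -
  obtain x y where xy: "f = {x, y}" "x \<in> e" "y \<notin> e"
    using G e f by (rule adjacent_edgeE)
  note upd = vertex_product_update[of V E e l, OF G e nz[OF e]]
  have "c = l e * vertex_product E l y / vertex_product E l x"
    if "conflict E (l(e := c)) f" for c
  proof -
    have "vertex_product E (l(e := c)) x = vertex_product E (l(e := c)) y"
      using that xy by (auto simp: conflict_def doubleton_eq_iff)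
    then have "c / l e * vertex_product E l x = vertex_product E l y"
      using xy by (simp add: upd)
    then show ?thesis
      using nz[OF e] vertex_product_nonzero[of V E l x, OF G nz] by (simp add: field_simps)
  qed
  then show ?thesis by blast
qed

text \<open>The greedy process: \<open>S\<close> holds the edges labelled so far, the others carry
  provisional labels. An edge \<open>f\<close> must be free of conflict once all its adjacent edges
  are in \<open>S\<close>, since labelling further edges can then no longer change its
  status.\<close>

lemma ex_labelling_no_conflict:
  assumes G: "simple_graph V E"
    and L: "\<And>e. e \<in> E \<Longrightarrow> card (adjacent_edges E e) < card (L e)"
    and L0: "\<And>e. e \<in> E \<Longrightarrow> 0 \<notin> L e"
    and S: "finite S" "S \<subseteq> E"
  shows "\<exists>l. labelling E L l \<and>
    (\<forall>f\<in>E. adjacent_edges E f \<noteq> {} \<and> adjacent_edges E f \<subseteq> S \<longrightarrow> \<not> conflict E l f)"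
  using S
proof (induction S)
  case empty
  \<comment> \<open>No nonempty set of adjacent edges lies in the empty \<open>S\<close>, so any
    choice from the nonempty lists will do.\<close>
  have "\<exists>c. c \<in> L e" if "e \<in> E" for e
    using L[OF that] by (metis all_not_in_conv card.empty not_less_zero)
  then have "labelling E L (\<lambda>e. SOME c. c \<in> L e)"
    by (auto simp: labelling_def intro: someI_ex)
  then show ?case by blast
next
  case (insert e S)
  then obtain l where l: "labelling E L l"
    "\<And>f. f \<in> E \<Longrightarrow> adjacent_edges E f \<noteq> {} \<Longrightarrow> adjacent_edges E f \<subseteq> S \<Longrightarrow> \<not> conflict E l f"
    by auto
  have e: "e \<in> E"
    using insert by simp
  have nz: "l e \<noteq> 0" if "e \<in> E" for e
    using l(1) L0 that by (metis labelling_def)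
  have "\<forall>f \<in> adjacent_edges E e. \<exists>b. \<forall>c. conflict E (l(e := c)) f \<longrightarrow> c = b"
    using conflict_value_unique[of V E l e, OF G nz e] by blast
  then obtain b where b: "\<And>f c. f \<in> adjacent_edges E e \<Longrightarrow> conflict E (l(e := c)) f \<Longrightarrow> c = b f"
    by metis
  have fin: "finite (adjacent_edges E e)"
    using finite_edges[OF G] by (simp add: adjacent_edges_def)
  \<comment> \<open>\<open>b f\<close> is the only label of \<open>e\<close> that can create a
    conflict at \<open>f\<close>, so there are fewer forbidden values than entries in the
    list.\<close>
  have "card (b ` adjacent_edges E e) < card (L e)"
    using card_image_le[OF fin, of b] L[OF e] by simp
  then have "\<not> L e \<subseteq> b ` adjacent_edges E e"
    using fin by (meson card_mono finite_imageI leD)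
  then obtain c where c: "c \<in> L e" "c \<notin> b ` adjacent_edges E e"
    by blast
  show ?case
  proof (intro exI conjI ballI impI)
    show "labelling E L (l(e := c))"
      using l(1) c(1) by (simp add: labelling_def)
    fix f assume f: "f \<in> E" "adjacent_edges E f \<noteq> {} \<and> adjacent_edges E f \<subseteq> insert e S"
    show "\<not> conflict E (l(e := c)) f"
    \<comment> \<open>If \<open>e\<close> is adjacent to \<open>f\<close>, then \<open>c\<close>
      avoids \<open>b f\<close>. Otherwise all edges adjacent to \<open>f\<close> were already in
      \<open>S\<close>, and the induction hypothesis survives the update.\<close>
    proof (cases "e \<in> adjacent_edges E f")
      case True
      then have "f \<in> adjacent_edges E e"
        using f(1) by (auto simp: adjacent_edges_def)
      then show ?thesis
        using b c(2) by blast
    next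
      case False
      have "c \<noteq> 0"
        using L0[OF e] c(1) by blast
      then show ?thesis
        using conflict_update_not_adjacent[of V E e l c f, OF G e nz[OF e] _ f(1) False]
          l(2)[OF f(1)] f(2) False
        by blast
    qed
  qed
qed

theorem theorem3p1:
  fixes V :: "'a set" and E :: "'a set set"
  assumes "simple_graph V E"
    and "E \<noteq> {}"
    and "nice V E"
  shows "ch_Pi_star E \<le> enat (2 * max_degree V E - 1)"
proof -
  let ?k = "2 * max_degree V E - 1"
  obtain e where e: "e \<in> E"
    using assms(2) by blast
  obtain x y where xy: "e = {x, y}" "x \<in> V"
    using assms(1) e by (rule edgeE)
  \<comment> \<open>Positivity keeps the truncated subtraction harmless: it gives
    \<open>1 \<le> ?k\<close> and makes \<open>?k\<close> exceed the bound
    \<open>2 * max_degree V E - 2\<close> on the number of adjacent edges.\<close>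
  have max_degree_pos: "1 \<le> max_degree V E"
    using degree_pos[of V E x y] degree_le_max_degree[OF assms(1) xy(2)] assms(1) e xy by simp
  have "p_proper_choosable E ?k"
    unfolding p_proper_choosable_def
  proof (intro allI impI)
    fix L :: "'a set \<Rightarrow> real set"
    assume L: "list_assignment E ?k L \<and> (\<forall>e\<in>E. 0 \<notin> L e)"
    have "card (adjacent_edges E e) < card (L e)" if "e \<in> E" for e
      using card_adjacent_edges_le[OF assms(1) that] that L max_degree_pos
      by (auto simp: list_assignment_def)
    moreover have "0 \<notin> L e" if "e \<in> E" for e
      using L that by blast
    ultimately obtain l where l: "labelling E L l"
      "\<And>f. f \<in> E \<Longrightarrow> adjacent_edges E f \<noteq> {} \<Longrightarrow> adjacent_edges E f \<subseteq> E \<Longrightarrow> \<not> conflict E l f"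
      using ex_labelling_no_conflict[OF assms(1) _ _ finite_edges[OF assms(1)] order_refl, of L]
      by auto
    \<comment> \<open>With \<open>S = E\<close> every edge is decided, because by niceness each one
      has an adjacent edge.\<close>
    have "\<not> conflict E l f" if "f \<in> E" for f
      using l(2)[OF that adjacent_edges_nonempty[OF assms(1,3) that]]
      by (auto simp: adjacent_edges_def)
    then have "p_proper E l"
      using edge_ends_distinct[OF assms(1)] unfolding p_proper_def conflict_def by blast
    with l(1) show "\<exists>l. labelling E L l \<and> p_proper E l"
      by blast
  qed
  then show ?thesis
    unfolding ch_Pi_star_def using max_degree_pos by (intro INF_lower) auto
qed

end
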